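(* Let $\Omega$ be a finite set of states and let $D:\Delta^o(\Omega)\times\Delta(\Omega)\to\Delta(\Omega)$ be a bias function that is interior and satisfies eventual learning. Then the sender S gains from sequential persuasion in every 2-action persuasion environment (with state space $\Omega$ and a receiver R with bias $D$) if and only if $D$ is weakly Bayes plausible.
   Context: Basic notation. $\Omega$ is a finite set; $\Delta(\Omega)$ is the set of probability vectors in $\mathbb{R}^\Omega$; $\Delta^o(\Omega)$ is the set of full-support beliefs. For a set $Y$, $\Delta(Y)$ denotes finite-support probability distributions on $Y$; $Conv$ is the convex hull. Persuasion environment. R has action set $A$ and utility $u(\omega,a)$; S has utility $v(\omega,a)$. S and R share a full-support common prior $\mu_0\in\Delta^o(\Omega)$. $\hat a(\mu)$ denotes an action maximizing $\mathbb{E}_{\omega\sim\mu}[u(\omega,a)]$ over $a\in A$ (assumed to exist); if R is indifferent, the S-optimal one among the maximizers is chosen. Bias. $D(\nu,\nu')$ is the belief R holds given prior $\nu\in\Delta^o(\Omega)$ and Bayesian posterior $\nu'\in\Delta(\Omega)$. Let $D^1(\nu,\nu')=D(\nu,\nu')$ and $D^n(\nu,\nu')=D(D^{n-1}(\nu,\nu'),\nu')$ for $n>1$. - $D$ is interior if $D(\nu,\nu')\in\Delta^o(\Omega)$ for all $\nu\in\Delta^o(\Omega)$, $\nu'\in\Delta(\Omega)$. - $D$ satisfies eventual learning if $\lim_n D^n(\nu,\nu')=\nu'$ for all $\nu\in\Delta^o(\Omega)$, $\nu'\in\Delta(\Omega)$. - $D$ is weakly Bayes plausible if for every $\nu\in\Delta^o(\Omega)$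 and every finite collection $\{\nu'_1,\ldots,\nu'_K\}\subseteq\Delta(\Omega)$ with $\nu\in Conv(\{\nu'_1,\ldots,\nu'_K\})$, one has $\nu\in Conv(\{D(\nu,\nu'_1),\ldots,D(\nu,\nu'_K)\})$. One-shot persuasion. S's optimal payoff with a single signal is $$V_D(\mu_0)=\max_\tau \sum_{\mu\in Supp(\tau)}\tau(\mu)\,\mathbb{E}_{\omega\sim\mu}[v(\omega,\hat a(D(\mu_0,\mu)))]\quad\text{s.t. } \sum_{\mu\in Supp(\tau)}\tau(\mu)\mu=\mu_0,$$ over finite-support $\tau\in\Delta(\Delta(\Omega))$; the maximum is assumed to be attained in the environments considered. Sequential persuasion. $X$ is a (sufficiently rich, e.g. infinite) set of signals; an information structure is a map $\Omega\to\Delta(X)$. A sequential persuasion strategy $\sigma$ specifies, as a function of the history $(x_1,\ldots,x_{n-1})$ of realized signals, either an information structure $\sigma_{x_1,\ldots,x_{n-1}}$ to be used next or termination; persuasion must terminate in finite time (the length may depend on realizations). R's belief starts at $\mu_0$ and is updated recursively: $\mu^\sigma(x_1,\ldots,x_n)=D(\mu^\sigma(x_1,\ldots,x_{n-1}),\mu)$, where $\mu$ is the Bayesian posterior computed from prior $\mu^\sigma(x_1,\ldots,x_{n-1})$, the information structure $\sigma_{x_1,\ldots,x_{n-1}}$ and the realized signal $x_n$ (with $\mu^\sigma(\emptyset)=\mu_0$). Conditional on state $\omega$, a signal sequence has probability $\prod_{k}\sigma_{x_1,\ldots,x_{k-1}}(x_k|\omega)$. S's payoff from $\sigma$ is the expectation,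 over $\omega\sim\mu_0$ and the terminal signal sequence, of $v(\omega,\hat a(\mu'))$, where $\mu'$ is R's final belief. S gains from sequential persuasion if there is a sequential persuasion strategy whose payoff to S is strictly higher than $V_D(\mu_0)$. 2-action persuasion environment. $A=\{a,a'\}$; S's utility does not depend on the state, with $v(a)>v(a')$; the (full-support) prior $\mu_0$ satisfies $\hat a(\mu_0)=a'$; and there is some $\mu\in\Delta^o(\Omega)$ with $\hat a(\mu)=a$. The choice of the environment includes the choice of $u$, $v$ and $\mu_0$. *)

theory Defs
  imports "HOL-Probability.Probability"
begin

section \<open>Beliefs and bias\<close>

text \<open>The finite state space is the universe of a type of class finite; beliefs are vectors.\<close>

definition beliefs :: "(real ^ 'w::finite) set" where
  "beliefs = {p. (\<forall>w. 0 \<le> p $ w) \<and> (\<Sum>w\<in>UNIV. p $ w) = 1}"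

definition full_beliefs :: "(real ^ 'w::finite) set" where
  "full_beliefs = {p \<in> beliefs. \<forall>w. 0 < p $ w}"

type_synonym 'w bias = "real ^ 'w \<Rightarrow> real ^ 'w \<Rightarrow> real ^ 'w"

text \<open>A bias is represented by a total function of which only the values on
  \<open>full_beliefs \<times> beliefs\<close> (prior, Bayesian posterior) matter.\<close>

definition is_bias :: "'w::finite bias \<Rightarrow> bool" where
  "is_bias D \<longleftrightarrow> (\<forall>\<nu>\<in>full_beliefs. \<forall>\<nu>'\<in>beliefs. D \<nu> \<nu>' \<in> beliefs)"

definition interior_bias :: "'w::finite bias \<Rightarrow> bool" where
  "interior_bias D \<longleftrightarrow> (\<forall>\<nu>\<in>full_beliefs. \<forall>\<nu>'\<in>beliefs. D \<nu> \<nu>' \<in> full_beliefs)"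

definition iterate_bias :: "'w::finite bias \<Rightarrow> nat \<Rightarrow> real ^ 'w \<Rightarrow> real ^ 'w \<Rightarrow> real ^ 'w" where
  "iterate_bias D n \<nu> \<nu>' = ((\<lambda>\<mu>. D \<mu> \<nu>') ^^ n) \<nu>"

definition eventual_learning :: "'w::finite bias \<Rightarrow> bool" where
  "eventual_learning D \<longleftrightarrow>
    (\<forall>\<nu>\<in>full_beliefs. \<forall>\<nu>'\<in>beliefs. (\<lambda>n. iterate_bias D n \<nu> \<nu>') \<longlonglongrightarrow> \<nu>')"

definition weakly_Bayes_plausible :: "'w::finite bias \<Rightarrow> bool" where
  "weakly_Bayes_plausible D \<longleftrightarrow>
    (\<forall>\<nu>\<in>full_beliefs. \<forall>F. finite F \<and> F \<subseteq> beliefs \<and> \<nu> \<in> convex hull F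
      \<longrightarrow> \<nu> \<in> convex hull (D \<nu> ` F))"


section \<open>The receiver's action\<close>

definition expect :: "real ^ 'w::finite \<Rightarrow> ('w \<Rightarrow> real) \<Rightarrow> real" where
  "expect \<mu> f = (\<Sum>w\<in>UNIV. \<mu> $ w * f w)"

definition best_actions :: "'a set \<Rightarrow> ('w \<Rightarrow> 'a \<Rightarrow> real) \<Rightarrow> real ^ 'w::finite \<Rightarrow> 'a set" where
  "best_actions A u \<mu> =
    {a \<in> A. \<forall>b\<in>A. expect \<mu> (\<lambda>w. u w b) \<le> expect \<mu> (\<lambda>w. u w a)}"

text \<open>Ties of the receiver are broken in favour of the sender; if the sender is indifferent as
  well, an arbitrary but fixed action is chosen.\<close>

definition receiver_action ::
    "'a set \<Rightarrow> ('w \<Rightarrow> 'a \<Rightarrow> real) \<Rightarrow> ('w \<Rightarrow> 'a \<Rightarrow> real) \<Rightarrow> real ^ 'w::finite \<Rightarrow> 'a" where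
  "receiver_action A u v \<mu> =
    (SOME a. a \<in> best_actions A u \<mu> \<and>
       (\<forall>b\<in>best_actions A u \<mu>. expect \<mu> (\<lambda>w. v w b) \<le> expect \<mu> (\<lambda>w. v w a)))"


section \<open>One-shot persuasion\<close>

definition one_shot_feasible :: "real ^ 'w::finite \<Rightarrow> (real ^ 'w) pmf set" where
  "one_shot_feasible \<mu>0 =
    {\<tau>. finite (set_pmf \<tau>) \<and> set_pmf \<tau> \<subseteq> beliefs \<and> (\<Sum>\<mu>\<in>set_pmf \<tau>. pmf \<tau> \<mu> *\<^sub>R \<mu>) = \<mu>0}"

definition one_shot_payoff ::
    "'w::finite bias \<Rightarrow> 'a set \<Rightarrow> ('w \<Rightarrow> 'a \<Rightarrow> real) \<Rightarrow> ('w \<Rightarrow> 'a \<Rightarrow> real) \<Rightarrow> real ^ 'w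
      \<Rightarrow> (real ^ 'w) pmf \<Rightarrow> real" where
  "one_shot_payoff D A u v \<mu>0 \<tau> =
    (\<Sum>\<mu>\<in>set_pmf \<tau>. pmf \<tau> \<mu> * expect \<mu> (\<lambda>w. v w (receiver_action A u v (D \<mu>0 \<mu>))))"

definition one_shot_max_attained ::
    "'w::finite bias \<Rightarrow> 'a set \<Rightarrow> ('w \<Rightarrow> 'a \<Rightarrow> real) \<Rightarrow> ('w \<Rightarrow> 'a \<Rightarrow> real) \<Rightarrow> real ^ 'w \<Rightarrow> bool" where
  "one_shot_max_attained D A u v \<mu>0 \<longleftrightarrow>
    (\<exists>\<tau>\<in>one_shot_feasible \<mu>0. \<forall>\<tau>'\<in>one_shot_feasible \<mu>0.
       one_shot_payoff D A u v \<mu>0 \<tau>' \<le> one_shot_payoff D A u v \<mu>0 \<tau>)"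

text \<open>Meaningful only under \<open>one_shot_max_attained\<close>.\<close>

definition one_shot_value ::
    "'w::finite bias \<Rightarrow> 'a set \<Rightarrow> ('w \<Rightarrow> 'a \<Rightarrow> real) \<Rightarrow> ('w \<Rightarrow> 'a \<Rightarrow> real) \<Rightarrow> real ^ 'w \<Rightarrow> real" where
  "one_shot_value D A u v \<mu>0 =
    (GREATEST y. y \<in> one_shot_payoff D A u v \<mu>0 ` one_shot_feasible \<mu>0)"


section \<open>Sequential persuasion\<close>

type_synonym ('w, 'x) info = "'w \<Rightarrow> 'x pmf"

definition info_structure :: "'x set \<Rightarrow> ('w, 'x) info \<Rightarrow> bool" where
  "info_structure X s \<longleftrightarrow> (\<forall>w. finite (set_pmf (s w)) \<and> set_pmf (s w) \<subseteq> X)"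

definition bayes_posterior :: "real ^ 'w::finite \<Rightarrow> ('w, 'x) info \<Rightarrow> 'x \<Rightarrow> real ^ 'w" where
  "bayes_posterior \<nu> s x =
    (\<chi> w. \<nu> $ w * pmf (s w) x / (\<Sum>w'\<in>UNIV. \<nu> $ w' * pmf (s w') x))"

text \<open>Given the history of past signals (in chronological order), a strategy either prescribes
  the next information structure or terminates (\<open>None\<close>).\<close>

type_synonym ('w, 'x) strategy = "'x list \<Rightarrow> ('w, 'x) info option"

text \<open>The histories that occur with positive probability in state \<open>w\<close>.\<close>

definition realizable :: "('w, 'x) strategy \<Rightarrow> 'w \<Rightarrow> 'x list \<Rightarrow> bool" where
  "realizable \<sigma> w h \<longleftrightarrow>
    (\<forall>k<length h. \<exists>s. \<sigma> (take k h) = Some s \<and> h ! k \<in> set_pmf (s w))"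

text \<open>Termination: in no state is there an infinite sequence of signals along which the strategy
  runs forever. There is no bound on the length of the realized histories.\<close>

definition sequential_strategy :: "'x set \<Rightarrow> ('w, 'x) strategy \<Rightarrow> bool" where
  "sequential_strategy X \<sigma> \<longleftrightarrow>
    (\<forall>h\<in>lists X. \<forall>s. \<sigma> h = Some s \<longrightarrow> info_structure X s) \<and>
    (\<forall>w. \<not> (\<exists>x::nat \<Rightarrow> 'x. \<forall>n. realizable \<sigma> w (map x [0..<n])))"

function receiver_belief ::
    "'w::finite bias \<Rightarrow> real ^ 'w \<Rightarrow> ('w, 'x) strategy \<Rightarrow> 'x list \<Rightarrow> real ^ 'w" where
  "receiver_belief D \<mu>0 \<sigma> [] = \<mu>0"
| "receiver_belief D \<mu>0 \<sigma> (h @ [x]) =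
    D (receiver_belief D \<mu>0 \<sigma> h)
      (bayes_posterior (receiver_belief D \<mu>0 \<sigma> h) (the (\<sigma> h)) x)"
  by (metis rev_exhaust surj_pair) auto
termination
  by (relation "Wellfounded.measure (\<lambda>(D, \<mu>0, \<sigma>, h). length h)") auto

definition terminal_histories :: "('w, 'x) strategy \<Rightarrow> 'w \<Rightarrow> 'x list set" where
  "terminal_histories \<sigma> w = {h. \<sigma> h = None \<and> realizable \<sigma> w h}"

definition history_prob :: "('w, 'x) strategy \<Rightarrow> 'w \<Rightarrow> 'x list \<Rightarrow> real" where
  "history_prob \<sigma> w h = (\<Prod>k<length h. pmf (the (\<sigma> (take k h)) w) (h ! k))"

text \<open>For a \<open>sequential_strategy\<close>, the realizable histories in a state form a finitely branching
  tree without infinite paths, so the inner sum is over a finite set.\<close>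

definition sequential_payoff ::
    "'w::finite bias \<Rightarrow> 'a set \<Rightarrow> ('w \<Rightarrow> 'a \<Rightarrow> real) \<Rightarrow> ('w \<Rightarrow> 'a \<Rightarrow> real) \<Rightarrow> real ^ 'w
      \<Rightarrow> ('w, 'x) strategy \<Rightarrow> real" where
  "sequential_payoff D A u v \<mu>0 \<sigma> =
    expect \<mu>0 (\<lambda>w. \<Sum>h\<in>terminal_histories \<sigma> w.
      history_prob \<sigma> w h * v w (receiver_action A u v (receiver_belief D \<mu>0 \<sigma> h)))"

definition gains_from_sequential_persuasion ::
    "'x set \<Rightarrow> 'w::finite bias \<Rightarrow> 'a set \<Rightarrow> ('w \<Rightarrow> 'a \<Rightarrow> real) \<Rightarrow> ('w \<Rightarrow> 'a \<Rightarrow> real) \<Rightarrow> real ^ 'w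
      \<Rightarrow> bool" where
  "gains_from_sequential_persuasion X D A u v \<mu>0 \<longleftrightarrow>
    (\<exists>\<sigma>. sequential_strategy X \<sigma> \<and>
       sequential_payoff D A u v \<mu>0 \<sigma> > one_shot_value D A u v \<mu>0)"


section \<open>Two-action environments\<close>

definition two_action_environment ::
    "'a set \<Rightarrow> ('w \<Rightarrow> 'a \<Rightarrow> real) \<Rightarrow> ('w \<Rightarrow> 'a \<Rightarrow> real) \<Rightarrow> real ^ 'w::finite \<Rightarrow> bool" where
  "two_action_environment A u v \<mu>0 \<longleftrightarrow>
    \<mu>0 \<in> full_beliefs \<and>
    (\<exists>a a'. A = {a, a'} \<and>
       (\<forall>b\<in>A. \<forall>w w'. v w b = v w' b) \<and>
       (\<forall>w. v w a > v w a') \<and>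
       receiver_action A u v \<mu>0 = a' \<and>
       (\<exists>\<mu>\<in>full_beliefs. receiver_action A u v \<mu> = a))"

end

theory Submission
  imports Defs
begin

text \<open>
  In a two-action environment the receiver takes the sender's preferred action exactly on a
  half-space of beliefs. If the bias is weakly Bayes plausible, an optimal one-shot experiment must
  leave the receiver outside this half-space with positive probability. There the sender repeats an
  experiment that has a fixed full-support posterior in the interior of the half-space among its
  outcomes: by eventual learning, a long enough run of that outcome persuades the receiver, and it
  has positive probability in every state. Conversely, a hyperplane that separates \<open>\<nu>\<close> from the
  distorted posteriors \<open>D \<nu> ` F\<close> defines an environment in which a single signal already yields the
  preferred action with certainty, so nothing is left to gain.
\<close>

section \<open>Beliefs\<close>

lemma full_beliefs_subset: "full_beliefs \<subseteq> beliefs"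
  by (auto simp: full_beliefs_def)

lemma belief_le_1: "p \<in> beliefs \<Longrightarrow> p $ w \<le> 1"
  unfolding beliefs_def using member_le_sum[of w UNIV "\<lambda>w. p $ w"] by auto

lemma expect_const: "p \<in> beliefs \<Longrightarrow> expect p (\<lambda>w. c) = c"
  by (simp add: expect_def beliefs_def flip: sum_distrib_right)

lemma expect_diff: "expect p (\<lambda>w. f w - g w) = expect p f - expect p g"
  by (simp add: expect_def algebra_simps sum_subtractf)

lemma expect_inner: "expect p f = (\<chi> w. f w) \<bullet> p"
  by (simp add: expect_def inner_vec_def mult.commute)

lemma full_belief_lower_bound:
  assumes "p \<in> full_beliefs"
  obtains c where "0 < c" "c < 1" "\<And>w. c < p $ w"
proof -
  \<comment> \<open>Half the minimum, so that \<open>c\<close> lies strictly below every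
    coordinate.\<close>
  define c where "c = Min (range (($) p)) / 2"
  have pos: "0 < p $ w" for w
    using assms by (auto simp: full_beliefs_def)
  have min: "Min (range (($) p)) \<le> p $ w" for w
    by simp
  have "0 < Min (range (($) p))"
    using pos by simp
  then have "0 < c" "c < p $ w" for w
    using min[of w] unfolding c_def by linarith+
  moreover have "p $ w \<le> 1" for w
    using assms belief_le_1 full_beliefs_subset by blast
  ultimately show ?thesis
    using that[of c] by (meson less_le_trans)
qed

section \<open>Realizing splittings of a prior by signals\<close>

lemma ex_pmf_image:
  fixes g :: "'i \<Rightarrow> real"
  assumes "finite I" "inj_on e I" "\<And>i. i \<in> I \<Longrightarrow> 0 \<le> g i" "sum g I = 1"
  shows "\<exists>p. set_pmf p \<subseteq> e ` I \<and> (\<forall>i\<in>I. pmf p (e i) = g i)"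
proof -
  define f where "f x = (if x \<in> e ` I then g (inv_into I e x) else 0)" for x
  have nonneg: "0 \<le> f x" for x
    using assms(3) by (auto simp: f_def inv_into_into)
  have "(\<integral>\<^sup>+ x. ennreal (f x) \<partial>count_space UNIV) = (\<Sum>x\<in>e ` I. ennreal (f x))"
    using assms(1) by (intro nn_integral_count_space') (auto simp: f_def)
  also have "\<dots> = ennreal (\<Sum>x\<in>e ` I. f x)"
    using nonneg by simp
  also have "(\<Sum>x\<in>e ` I. f x) = (\<Sum>i\<in>I. g i)"
    using assms(2) by (subst sum.reindex) (auto simp: f_def intro!: sum.cong)
  finally have int: "(\<integral>\<^sup>+ x. ennreal (f x) \<partial>count_space UNIV) = 1"
    using assms(4) by simp
  have "pmf (embed_pmf f) x = f x" for x
    using pmf_embed_pmf[OF nonneg int] .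
  moreover have "set_pmf (embed_pmf f) \<subseteq> e ` I"
    unfolding set_embed_pmf[OF nonneg int] by (auto simp: f_def)
  ultimately show ?thesis
    using assms(2) by (intro exI[of _ "embed_pmf f"]) (auto simp: f_def)
qed

text \<open>Bayes' rule run backwards: the joint probability of state \<open>w\<close> and signal
  \<open>e i\<close> is set to \<open>c i * m i $ w\<close>, so the signal has total mass
  \<open>c i\<close> and posterior \<open>m i\<close>. Since the means agree, the conditional
  probabilities sum to one in each state. Indexing by \<open>I\<close> lets two signals induce the
  same posterior.\<close>

lemma ex_info_structure_splitting:
  fixes \<nu> :: "real ^ 'w::finite" and m :: "'i \<Rightarrow> real ^ 'w" and e :: "'i \<Rightarrow> 'x"
  assumes full: "\<nu> \<in> full_beliefs"
    and I: "finite I" "inj_on e I" "e ` I \<subseteq> X"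
    and m: "\<And>i. i \<in> I \<Longrightarrow> m i \<in> beliefs"
    and c: "\<And>i. i \<in> I \<Longrightarrow> 0 < c i" and mean: "(\<Sum>i\<in>I. c i *\<^sub>R m i) = \<nu>"
  obtains s where "info_structure X s" "\<And>w. set_pmf (s w) \<subseteq> e ` I"
    "\<And>i w. i \<in> I \<Longrightarrow> pmf (s w) (e i) = c i * m i $ w / \<nu> $ w"
    "\<And>i. i \<in> I \<Longrightarrow> bayes_posterior \<nu> s (e i) = m i"
proof -
  have pos: "0 < \<nu> $ w" for w
    using full by (auto simp: full_beliefs_def)
  have "\<exists>p. set_pmf p \<subseteq> e ` I \<and> (\<forall>i\<in>I. pmf p (e i) = c i * m i $ w / \<nu> $ w)" for w
  proof (rule ex_pmf_image[OF I(1,2)])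
    show "0 \<le> c i * m i $ w / \<nu> $ w" if "i \<in> I" for i
      using m[OF that] c[OF that] pos[of w] by (auto simp: beliefs_def)
    have "(\<Sum>i\<in>I. c i * m i $ w) = \<nu> $ w"
      by (simp flip: mean)
    then show "(\<Sum>i\<in>I. c i * m i $ w / \<nu> $ w) = 1"
      using pos[of w] by (simp flip: sum_divide_distrib)
  qed
  then obtain s where s: "\<And>w. set_pmf (s w) \<subseteq> e ` I"
    "\<And>i w. i \<in> I \<Longrightarrow> pmf (s w) (e i) = c i * m i $ w / \<nu> $ w"
    by metis
  show ?thesis
  proof (rule that[OF _ s])
    show "info_structure X s"
      unfolding info_structure_def using s(1) I by (meson finite_imageI finite_subset subset_trans)
    fix i assume i: "i \<in> I"
    have joint: "\<nu> $ w * pmf (s w) (e i) = c i * m i $ w" for w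
      using s(2)[OF i, of w] pos[of w] by simp
    have "(\<Sum>w\<in>UNIV. c i * m i $ w) = c i"
      using m[OF i] by (simp add: beliefs_def flip: sum_distrib_left)
    then show "bayes_posterior \<nu> s (e i) = m i"
      using c[OF i] by (simp add: bayes_posterior_def joint vec_eq_iff)
  qed
qed

section \<open>Continuation values\<close>

text \<open>Kept conditional on the state, because signals are drawn from the true state while R's
  belief is distorted by \<open>D\<close> and need not be the correct posterior. \<open>g\<close> is
  the payoff as a function of R's final belief.\<close>

definition continuation_value ::
    "'w::finite bias \<Rightarrow> (real ^ 'w \<Rightarrow> real) \<Rightarrow> ('w, 'x) strategy \<Rightarrow> real ^ 'w \<Rightarrow> 'w \<Rightarrow> real" where
  "continuation_value D g \<sigma> \<nu> w =
    (\<Sum>h\<in>terminal_histories \<sigma> w. history_prob \<sigma> w h * g (receiver_belief D \<nu> \<sigma> h))"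

lemma sequential_payoff_eq_continuation_value:
  "sequential_payoff D A u v \<mu>0 \<sigma> =
    expect \<mu>0 (\<lambda>w. continuation_value D (\<lambda>\<mu>. v w (receiver_action A u v \<mu>)) \<sigma> \<mu>0 w)"
  by (simp add: sequential_payoff_def continuation_value_def)

section \<open>Building strategies from the first signal\<close>

definition stop_strategy :: "('w, 'x) strategy" where
  "stop_strategy h = None"

definition branch_strategy ::
    "('w, 'x) info \<Rightarrow> ('x \<Rightarrow> ('w, 'x) strategy) \<Rightarrow> ('w, 'x) strategy" where
  "branch_strategy s \<tau> h = (case h of [] \<Rightarrow> Some s | x # h' \<Rightarrow> \<tau> x h')"

text \<open>A uniform bound on the length, stronger than pathwise termination. It supports induction
  and holds for all strategies constructed below.\<close>

definition bounded_strategy :: "'x set \<Rightarrow> nat \<Rightarrow> ('w, 'x) strategy \<Rightarrow> bool" where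
  "bounded_strategy X N \<sigma> \<longleftrightarrow>
    (\<forall>h\<in>lists X. \<forall>s. \<sigma> h = Some s \<longrightarrow> info_structure X s \<and> length h < N)"

lemma realizable_Nil [simp]: "realizable \<sigma> w []"
  by (simp add: realizable_def)

lemma realizable_Cons:
  "realizable \<sigma> w (x # h) \<longleftrightarrow>
    (\<exists>s. \<sigma> [] = Some s \<and> x \<in> set_pmf (s w)) \<and> realizable (\<lambda>h. \<sigma> (x # h)) w h"
  unfolding realizable_def by (simp add: All_less_Suc2)

lemma realizable_stopped: "\<sigma> [] = None \<Longrightarrow> realizable \<sigma> w h \<longleftrightarrow> h = []"
  by (cases h) (auto simp: realizable_Cons)

lemma realizable_snoc:
  "realizable \<sigma> w (h @ [x]) \<longleftrightarrow> realizable \<sigma> w h \<and> (\<exists>s. \<sigma> h = Some s \<and> x \<in> set_pmf (s w))"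
  unfolding realizable_def by (auto simp: All_less_Suc nth_append)

lemma history_prob_Nil [simp]: "history_prob \<sigma> w [] = 1"
  by (simp add: history_prob_def)

lemma history_prob_Cons:
  "history_prob \<sigma> w (x # h) = pmf (the (\<sigma> []) w) x * history_prob (\<lambda>h. \<sigma> (x # h)) w h"
  by (simp add: history_prob_def prod.lessThan_Suc_shift del: prod.lessThan_Suc)

lemma history_prob_nonneg: "0 \<le> history_prob \<sigma> w h"
  by (simp add: history_prob_def prod_nonneg)

text \<open>\<open>receiver_belief\<close> recurses on the last signal, whereas strategies are
  composed at the first one; reverse induction mediates between the two.\<close>

lemma receiver_belief_Cons:
  "receiver_belief D \<nu> \<sigma> (x # h) =
    receiver_belief D (D \<nu> (bayes_posterior \<nu> (the (\<sigma> [])) x)) (\<lambda>h. \<sigma> (x # h)) h"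
proof (induction h rule: rev_induct)
  case Nil
  show ?case
    using receiver_belief.simps(2)[of D \<nu> \<sigma> "[]" x] by simp
next
  case (snoc y h)
  then show ?case
    using receiver_belief.simps(2)[of D \<nu> \<sigma> "x # h" y] by simp
qed

lemma branch_strategy_simps [simp]:
  "branch_strategy s \<tau> [] = Some s"
  "branch_strategy s \<tau> (x # h) = \<tau> x h"
  by (simp_all add: branch_strategy_def)

lemma terminal_histories_stop [simp]: "terminal_histories stop_strategy w = {[]}"
proof -
  have "realizable stop_strategy w h \<longleftrightarrow> h = []" for h
    by (rule realizable_stopped) (simp add: stop_strategy_def)
  then show ?thesis
    by (auto simp: terminal_histories_def stop_strategy_def)
qed

lemma terminal_histories_branch:
  "terminal_histories (branch_strategy s \<tau>) w =
    (\<Union>x\<in>set_pmf (s w). (#) x ` terminal_histories (\<tau> x) w)" (is "?L = ?R")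
proof (rule set_eqI)
  show "h \<in> ?L \<longleftrightarrow> h \<in> ?R" for h
    by (cases h) (auto simp: terminal_histories_def realizable_Cons)
qed

lemma continuation_value_stop [simp]: "continuation_value D g stop_strategy \<nu> w = g \<nu>"
  by (simp add: continuation_value_def)

text \<open>Total probability over the first signal. \<open>Y\<close> may exceed the support, where
  \<open>pmf\<close> vanishes, so that one index set can serve all states.\<close>

lemma continuation_value_branch:
  assumes "finite Y" "set_pmf (s w) \<subseteq> Y"
    and "\<And>x. x \<in> set_pmf (s w) \<Longrightarrow> finite (terminal_histories (\<tau> x) w)"
  shows "continuation_value D g (branch_strategy s \<tau>) \<nu> w =
    (\<Sum>x\<in>Y. pmf (s w) x * continuation_value D g (\<tau> x) (D \<nu> (bayes_posterior \<nu> s x)) w)"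
proof -
  have "finite (set_pmf (s w))"
    using assms finite_subset by blast
  then have "continuation_value D g (branch_strategy s \<tau>) \<nu> w =
    (\<Sum>x\<in>set_pmf (s w). \<Sum>h\<in>(#) x ` terminal_histories (\<tau> x) w.
      history_prob (branch_strategy s \<tau>) w h * g (receiver_belief D \<nu> (branch_strategy s \<tau>) h))"
    unfolding continuation_value_def terminal_histories_branch
    using assms(3) by (intro sum.UNION_disjoint) auto
  also have "\<dots> = (\<Sum>x\<in>set_pmf (s w).
      pmf (s w) x * continuation_value D g (\<tau> x) (D \<nu> (bayes_posterior \<nu> s x)) w)"
    unfolding continuation_value_def
    by (subst sum.reindex)
      (simp_all add: history_prob_Cons receiver_belief_Cons sum_distrib_left mult.assoc)
  also have "\<dots> = (\<Sum>x\<in>Y.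
      pmf (s w) x * continuation_value D g (\<tau> x) (D \<nu> (bayes_posterior \<nu> s x)) w)"
    using assms by (intro sum.mono_neutral_left) (auto simp: set_pmf_iff)
  finally show ?thesis .
qed

section \<open>Strategies of bounded length\<close>

lemma bounded_strategy_stop [simp]: "bounded_strategy X N stop_strategy"
  by (simp add: bounded_strategy_def stop_strategy_def)

lemma bounded_strategy_branch:
  assumes "info_structure X s" "\<And>x. x \<in> X \<Longrightarrow> bounded_strategy X N (\<tau> x)"
  shows "bounded_strategy X (Suc N) (branch_strategy s \<tau>)"
  unfolding bounded_strategy_def
proof (intro ballI allI impI)
  fix h t assume "h \<in> lists X" "branch_strategy s \<tau> h = Some t"
  then show "info_structure X t \<and> length h < Suc N"
    using assms by (cases h) (auto simp: bounded_strategy_def)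
qed

lemma finite_terminal_histories:
  "bounded_strategy X N \<sigma> \<Longrightarrow> finite (terminal_histories \<sigma> w)"
proof (induction N arbitrary: \<sigma>)
  case 0
  then have "\<sigma> [] = None"
    by (cases "\<sigma> []") (auto simp: bounded_strategy_def)
  then have "terminal_histories \<sigma> w \<subseteq> {[]}"
    by (auto simp: terminal_histories_def realizable_stopped)
  then show ?case
    using finite_subset by blast
next
  case (Suc N)
  show ?case
  proof (cases "\<sigma> []")
    case None
    then have "terminal_histories \<sigma> w \<subseteq> {[]}"
      by (auto simp: terminal_histories_def realizable_stopped)
    then show ?thesis
      using finite_subset by blast
  next
    case (Some s)
    \<comment> \<open>A strategy that does not stop at once is a \<open>branch_strategy\<close>; its
      tails satisfy the bound lowered by one, and only finitely many of them are reached.\<close>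
    define \<tau> where "\<tau> x h = \<sigma> (x # h)" for x h
    have \<sigma>: "\<sigma> = branch_strategy s \<tau>"
      by (rule ext) (auto simp: branch_strategy_def \<tau>_def Some split: list.splits)
    have s: "finite (set_pmf (s w))" "set_pmf (s w) \<subseteq> X"
      using Suc.prems Some by (auto simp: bounded_strategy_def info_structure_def)
    have "bounded_strategy X N (\<tau> x)" if "x \<in> X" for x
      unfolding bounded_strategy_def
    proof (intro ballI allI impI)
      fix h t assume "h \<in> lists X" "\<tau> x h = Some t"
      then have "info_structure X t \<and> length (x # h) < Suc N"
        using Suc.prems[unfolded bounded_strategy_def, rule_format, of "x # h" t] that
        by (simp add: \<tau>_def)
      then show "info_structure X t \<and> length h < N"
        by simp
    qed
    then show ?thesis
      unfolding \<sigma> terminal_histories_branch using s Suc.IH by blast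
  qed
qed

lemma bounded_imp_sequential_strategy:
  assumes "bounded_strategy X N \<sigma>"
  shows "sequential_strategy X \<sigma>"
proof -
  have info: "info_structure X s" if "h \<in> lists X" "\<sigma> h = Some s" for h s
    using assms that by (auto simp: bounded_strategy_def)
  \<comment> \<open>The bound speaks only of histories over \<open>X\<close>; realizable ones
    qualify because the supports of information structures lie in \<open>X\<close>.\<close>
  have lists: "h \<in> lists X" if "realizable \<sigma> w h" for w h
    using that
  proof (induction h rule: rev_induct)
    case (snoc x h)
    then show ?case
      using info by (fastforce simp: realizable_snoc info_structure_def)
  qed simp
  \<comment> \<open>A realizable history of length \<open>Suc N\<close> would force
    \<open>\<sigma>\<close> to continue at a prefix of length \<open>N\<close>, which the bound
    excludes.\<close>
  have "\<not> realizable \<sigma> w (map x [0..<Suc N])" for w x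
  proof
    assume "realizable \<sigma> w (map x [0..<Suc N])"
    then obtain s where "\<sigma> (map x [0..<N]) = Some s" "map x [0..<N] \<in> lists X"
      using lists by (auto simp: realizable_snoc)
    then show False
      using assms unfolding bounded_strategy_def by fastforce
  qed
  then show ?thesis
    using info unfolding sequential_strategy_def by blast
qed

section \<open>Persuasion by repetition\<close>

text \<open>Each stage gives posterior \<open>\<nu>'\<close> a small weight and stops after the
  other signal, where the payoff is at least \<open>l\<close>. Since \<open>\<nu>'\<close> has full
  support, the run of \<open>n\<close> good signals has positive probability in every state. The
  strict gain thus holds statewise, whatever the true posterior is.\<close>

lemma persuade_with_positive_probability:
  fixes D :: "'w::finite bias" and X :: "'x set"
  assumes D: "interior_bias D" and X: "infinite X"
    and low: "\<And>\<mu>. \<mu> \<in> full_beliefs \<Longrightarrow> l \<le> g \<mu>"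
    and "\<nu> \<in> full_beliefs" "\<nu>' \<in> full_beliefs" "l < g (iterate_bias D n \<nu> \<nu>')"
  shows "\<exists>\<sigma>. bounded_strategy X n \<sigma> \<and> (\<forall>w. l < continuation_value D g \<sigma> \<nu> w)"
  using assms(4-)
proof (induction n arbitrary: \<nu>)
  case 0
  then show ?case
    by (intro exI[of _ stop_strategy]) (simp add: iterate_bias_def)
next
  case (Suc n)
  have next_full: "D \<nu> \<mu> \<in> full_beliefs" if "\<mu> \<in> beliefs" for \<mu>
    using D Suc.prems(1) that by (auto simp: interior_bias_def)
  have \<nu>': "\<nu>' \<in> beliefs"
    using Suc.prems(2) full_beliefs_subset by blast
  \<comment> \<open>The first update leads to \<open>D \<nu> \<nu>'\<close>, from which
    \<open>n\<close> updates remain; hence the induction over all \<open>\<nu>\<close>.\<close>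
  have "l < g (iterate_bias D n (D \<nu> \<nu>') \<nu>')"
    using Suc.prems(3) by (simp add: iterate_bias_def funpow_Suc_right del: funpow.simps)
  then obtain \<sigma> where \<sigma>: "bounded_strategy X n \<sigma>"
    "\<And>w. l < continuation_value D g \<sigma> (D \<nu> \<nu>') w"
    using Suc.IH[OF next_full[OF \<nu>'] Suc.prems(2)] by blast
  obtain c where c: "0 < c" "c < 1" "\<And>w. c < \<nu> $ w"
    using full_belief_lower_bound[OF Suc.prems(1)] by blast
  \<comment> \<open>\<open>m False\<close> solves
    \<open>c *\<^sub>R \<nu>' + (1 - c) *\<^sub>R m False = \<nu>\<close>. It is nonnegative because
    \<open>c < \<nu> $ w\<close> and \<open>\<nu>' $ w \<le> 1\<close>.\<close>
  define m where "m b = (if b then \<nu>' else (1 / (1 - c)) *\<^sub>R (\<nu> - c *\<^sub>R \<nu>'))" for b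
  define p where "p b = (if b then c else 1 - c)" for b
  have "0 \<le> \<nu> $ w - c * \<nu>' $ w" for w
    using c(3)[of w] mult_left_le[OF belief_le_1[OF \<nu>', of w], of c] c(1) by linarith
  moreover have "(\<Sum>w\<in>UNIV. \<nu> $ w - c * \<nu>' $ w) = 1 - c"
    using Suc.prems(1) \<nu>'
    by (simp add: full_beliefs_def beliefs_def sum_subtractf flip: sum_distrib_left)
  ultimately have "m False \<in> beliefs"
    using c(2) by (simp add: m_def beliefs_def flip: sum_divide_distrib)
  then have m: "m b \<in> beliefs" for b
    using \<nu>' by (cases b) (auto simp: m_def)
  have mean: "(\<Sum>b\<in>UNIV. p b *\<^sub>R m b) = \<nu>"
    using c by (simp add: UNIV_bool p_def m_def)
  have p: "0 < p b" for b
    using c by (simp add: p_def)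
  obtain B where B: "finite B" "card B = 2" "B \<subseteq> X"
    using infinite_arbitrarily_large[OF X] by blast
  then obtain x y where xy: "x \<noteq> y" "x \<in> X" "y \<in> X"
    by (auto simp: card_2_iff)
  define e where "e b = (if b then x else y)" for b
  have inj: "inj_on e UNIV" and e: "e ` UNIV \<subseteq> X"
    using xy by (auto simp: e_def inj_on_def)
  obtain s where s: "info_structure X s" "\<And>w. set_pmf (s w) \<subseteq> range e"
    "\<And>b w. pmf (s w) (e b) = p b * m b $ w / \<nu> $ w"
    "\<And>b. bayes_posterior \<nu> s (e b) = m b"
    using ex_info_structure_splitting[OF Suc.prems(1) _ inj e m p mean] by auto
  define \<tau> where "\<tau> z = (if z = x then \<sigma> else stop_strategy)" for z
  have \<tau>: "bounded_strategy X n (\<tau> z)" for z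
    using \<sigma>(1) by (simp add: \<tau>_def)
  have "l < continuation_value D g (branch_strategy s \<tau>) \<nu> w" for w
  proof -
    let ?V = "\<lambda>b. continuation_value D g (\<tau> (e b)) (D \<nu> (m b)) w"
    have V: "continuation_value D g (branch_strategy s \<tau>) \<nu> w =
        (\<Sum>b\<in>UNIV. pmf (s w) (e b) * ?V b)"
      by (subst continuation_value_branch[of "range e"])
        (use s(2,4) finite_terminal_histories[OF \<tau>] in \<open>auto simp: sum.reindex[OF inj]\<close>)
    \<comment> \<open>Full support of \<open>\<nu>'\<close> enters here: the good signal is possible
      in each state.\<close>
    have "pmf (s w) (e True) > 0"
      using s(3)[of w True] c(1) Suc.prems(1,2) by (auto simp: p_def m_def full_beliefs_def)
    then have "pmf (s w) (e True) * l < pmf (s w) (e True) * ?V True"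
      using \<sigma>(2)[of w] by (simp add: \<tau>_def e_def m_def)
    moreover have "pmf (s w) (e False) * l \<le> pmf (s w) (e False) * ?V False"
      using low[OF next_full[OF m[of False]]] xy(1) by (simp add: \<tau>_def e_def mult_left_mono)
    moreover have "(\<Sum>b\<in>UNIV. pmf (s w) (e b)) = 1"
      using sum_pmf_eq_1[of "range e" "s w"] s(2)[of w] by (simp add: sum.reindex[OF inj])
    then have "pmf (s w) (e True) * l + pmf (s w) (e False) * l = l"
      by (simp add: UNIV_bool add.commute flip: distrib_right)
    ultimately show ?thesis
      unfolding V by (simp add: UNIV_bool)
  qed
  then show ?case
    using bounded_strategy_branch[OF s(1) \<tau>] by (intro exI[of _ "branch_strategy s \<tau>"] conjI allI)
qed

section \<open>The receiver's choice between two actions\<close>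

text \<open>When R is indifferent, the tie goes to \<open>a\<close> because
  \<open>r a' < r a\<close>. Hence the inequality is weak and the half-space of beliefs
  closed.\<close>

lemma receiver_action_two:
  fixes v :: "'w::finite \<Rightarrow> 'a \<Rightarrow> real"
  assumes \<mu>: "\<mu> \<in> beliefs" and v: "\<And>b w. b \<in> {a, a'} \<Longrightarrow> v w b = r b" and "r a' < r a"
  shows "receiver_action {a, a'} u v \<mu> =
    (if 0 \<le> expect \<mu> (\<lambda>w. u w a - u w a') then a else a')"
proof -
  have expect_v: "expect \<mu> (\<lambda>w. v w b) = r b" if "b \<in> {a, a'}" for b
    using v[OF that] expect_const[OF \<mu>] by simp
  have "a \<noteq> a'"
    using assms(3) by blast
  then show ?thesis
    using expect_v[of a] expect_v[of a'] assms(3) unfolding receiver_action_def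
    by (intro some_equality) (auto simp: best_actions_def expect_diff split: if_splits)
qed

lemma one_shot_value_eq:
  assumes "\<tau> \<in> one_shot_feasible \<mu>0"
    and "\<And>\<tau>'. \<tau>' \<in> one_shot_feasible \<mu>0 \<Longrightarrow>
      one_shot_payoff D A u v \<mu>0 \<tau>' \<le> one_shot_payoff D A u v \<mu>0 \<tau>"
  shows "one_shot_value D A u v \<mu>0 = one_shot_payoff D A u v \<mu>0 \<tau>"
  unfolding one_shot_value_def using assms by (intro Greatest_equality) auto

text \<open>Maximizers over a finite nonempty set exist for R and then for S, so the choice operator
  has a witness. As \<open>\<mu>\<close> is arbitrary, payoffs can later be rewritten without
  checking that it is a belief.\<close>

lemma receiver_action_in:
  assumes "finite A" "A \<noteq> {}"
  shows "receiver_action A u v \<mu> \<in> A"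
proof -
  have ex_max: "\<exists>a\<in>S. \<forall>b\<in>S. k b \<le> k a" if "finite S" "S \<noteq> {}" for S and k :: "'a \<Rightarrow> real"
    using Max_in[of "k ` S"] that
    by (metis (no_types, lifting) Max_ge finite_imageI imageE image_eqI image_is_empty)
  have "best_actions A u \<mu> \<noteq> {}"
    using ex_max[OF assms, of "\<lambda>a. expect \<mu> (\<lambda>w. u w a)"] by (auto simp: best_actions_def)
  moreover have "finite (best_actions A u \<mu>)"
    using assms(1) by (simp add: best_actions_def)
  ultimately have "\<exists>a. a \<in> best_actions A u \<mu> \<and>
      (\<forall>b\<in>best_actions A u \<mu>. expect \<mu> (\<lambda>w. v w b) \<le> expect \<mu> (\<lambda>w. v w a))"
    using ex_max[of "best_actions A u \<mu>" "\<lambda>a. expect \<mu> (\<lambda>w. v w a)"] by blast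
  then have "receiver_action A u v \<mu> \<in> best_actions A u \<mu>"
    unfolding receiver_action_def by (rule someI2_ex) blast
  then show ?thesis
    by (simp add: best_actions_def)
qed

text \<open>The minimum over the finitely many states is a single constant above \<open>l\<close>,
  so no state of positive weight has to be singled out.\<close>

lemma expect_gt:
  assumes p: "p \<in> beliefs" and f: "\<And>w. l < f w"
  shows "l < expect p f"
proof -
  have "l < Min (range f)"
    using f by simp
  also have "Min (range f) = expect p (\<lambda>w. Min (range f))"
    using expect_const[OF p] by simp
  also have "\<dots> \<le> expect p f"
    unfolding expect_def using p by (intro sum_mono mult_left_mono) (auto simp: beliefs_def)
  finally show ?thesis .
qed

lemma expect_nonpos:
  assumes "p \<in> beliefs" "\<And>w. f w \<le> 0"
  shows "expect p f \<le> 0"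
  unfolding expect_def using assms by (intro sum_nonpos mult_nonneg_nonpos) (auto simp: beliefs_def)

lemma iterate_bias_full:
  assumes "interior_bias D" "\<nu> \<in> full_beliefs" "\<nu>' \<in> beliefs"
  shows "iterate_bias D n \<nu> \<nu>' \<in> full_beliefs"
  using assms by (induction n) (auto simp: iterate_bias_def interior_bias_def)

section \<open>Weak Bayes plausibility implies a gain\<close>

lemma gains_if_weakly_Bayes_plausible:
  fixes D :: "'w::finite bias" and X :: "'x set" and A :: "'a set"
  assumes X: "infinite X" and D: "interior_bias D" and learn: "eventual_learning D"
    and plausible: "weakly_Bayes_plausible D"
    and env: "two_action_environment A u v \<mu>0" and att: "one_shot_max_attained D A u v \<mu>0"
  shows "gains_from_sequential_persuasion X D A u v \<mu>0"
proof -
  obtain a a' \<mu>1 where A: "A = {a, a'}" and \<mu>0: "\<mu>0 \<in> full_beliefs"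
    and const: "\<forall>b\<in>A. \<forall>w w'. v w b = v w' b" and gt: "\<forall>w. v w a' < v w a"
    and act0: "receiver_action A u v \<mu>0 = a'"
    and \<mu>1: "\<mu>1 \<in> full_beliefs" "receiver_action A u v \<mu>1 = a"
    using env unfolding two_action_environment_def by blast
  \<comment> \<open>\<open>undefined\<close> is just some state; \<open>v\<close> is constant in the
    state.\<close>
  define r where "r b = v undefined b" for b
  have v: "v w b = r b" if "b \<in> {a, a'}" for w b
    using const that unfolding r_def A by blast
  have r: "r a' < r a"
    using gt by (simp add: r_def)
  define f where "f w = u w a - u w a'" for w
  have act: "receiver_action A u v \<mu> = (if 0 \<le> expect \<mu> f then a else a')"
    if "\<mu> \<in> beliefs" for \<mu>
    unfolding A f_def using receiver_action_two[OF that v r] .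
  define g where "g \<mu> = r (receiver_action A u v \<mu>)" for \<mu>
  have v_g: "v w (receiver_action A u v \<mu>) = g \<mu>" for w \<mu>
    using receiver_action_in[of A u v \<mu>] v unfolding g_def by (simp add: A)
  have g: "g \<mu> = (if 0 \<le> expect \<mu> f then r a else r a')" if "\<mu> \<in> beliefs" for \<mu>
    by (simp add: g_def act[OF that])
  have bel: "\<mu> \<in> beliefs" if "\<mu> \<in> full_beliefs" for \<mu> :: "real ^ 'w"
    using that full_beliefs_subset by blast
  have f0: "expect \<mu>0 f < 0"
    using act[OF bel[OF \<mu>0]] act0 r by (auto split: if_splits)
  have f1: "0 \<le> expect \<mu>1 f"
    using act[OF bel[OF \<mu>1(1)]] \<mu>1(2) r by (auto split: if_splits)
  have D_full: "D \<mu>0 m \<in> full_beliefs" if "m \<in> beliefs" for m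
    using D \<mu>0 that by (auto simp: interior_bias_def)

  obtain \<tau> where \<tau>: "\<tau> \<in> one_shot_feasible \<mu>0"
    and opt: "\<And>\<tau>'. \<tau>' \<in> one_shot_feasible \<mu>0 \<Longrightarrow>
      one_shot_payoff D A u v \<mu>0 \<tau>' \<le> one_shot_payoff D A u v \<mu>0 \<tau>"
    using att unfolding one_shot_max_attained_def by blast
  let ?S = "set_pmf \<tau>"
  have S: "finite ?S" "\<And>m. m \<in> ?S \<Longrightarrow> m \<in> beliefs" and mean: "(\<Sum>m\<in>?S. pmf \<tau> m *\<^sub>R m) = \<mu>0"
    using \<tau> by (auto simp: one_shot_feasible_def)
  have "\<mu>0 \<in> convex hull ?S"
    using S(1) mean sum_pmf_eq_1[OF S(1), of \<tau>]
    by (auto simp: convex_hull_finite intro!: exI[of _ "pmf \<tau>"])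
  then have hull: "\<mu>0 \<in> convex hull (D \<mu>0 ` ?S)"
    using plausible \<mu>0 S unfolding weakly_Bayes_plausible_def by blast
  \<comment> \<open>Otherwise the half-space would contain all distorted posteriors, hence their
    convex hull and with it \<open>\<mu>0\<close>, contradicting \<open>f0\<close>.\<close>
  have "\<exists>m\<in>?S. expect (D \<mu>0 m) f < 0"
  proof (rule ccontr)
    assume "\<not> ?thesis"
    then have "D \<mu>0 ` ?S \<subseteq> {x. (\<chi> w. f w) \<bullet> x \<ge> 0}"
      by (auto simp: expect_inner not_less)
    then have "convex hull (D \<mu>0 ` ?S) \<subseteq> {x. (\<chi> w. f w) \<bullet> x \<ge> 0}"
      by (intro hull_minimal) (auto simp: convex_halfspace_ge)
    then show False
      using hull f0 by (auto simp: expect_inner)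
  qed
  then obtain ms where ms: "ms \<in> ?S" "expect (D \<mu>0 ms) f < 0"
    by blast
  have D_ms: "D \<mu>0 ms \<in> full_beliefs"
    using D_full S(2) ms(1) by blast

  obtain c where c: "0 < c" "c < 1" "\<And>w. c < \<mu>1 $ w"
    using full_belief_lower_bound[OF \<mu>1(1)] by blast
  \<comment> \<open>R may be indifferent at \<open>\<mu>1\<close>. Moving on from
    \<open>\<mu>1\<close> directly away from \<open>\<mu>0\<close> makes the inequality strict, and
    \<open>c\<close> is small enough to keep full support.\<close>
  define \<nu>' where "\<nu>' = \<mu>1 + c *\<^sub>R (\<mu>1 - \<mu>0)"
  have "0 < \<nu>' $ w" for w
  proof -
    have "c * \<mu>0 $ w \<le> c"
      using mult_left_le[OF belief_le_1[OF bel[OF \<mu>0]], of c w] c(1) by simp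
    moreover have "0 < c * \<mu>1 $ w"
      using c(1) \<mu>1(1) by (simp add: full_beliefs_def)
    ultimately show ?thesis
      using c(3)[of w] by (simp add: \<nu>'_def algebra_simps)
  qed
  moreover have "(\<Sum>w\<in>UNIV. \<nu>' $ w) = 1"
    using bel[OF \<mu>0] bel[OF \<mu>1(1)]
    by (simp add: \<nu>'_def beliefs_def sum.distrib sum_subtractf flip: sum_distrib_left)
  ultimately have \<nu>': "\<nu>' \<in> full_beliefs"
    by (auto simp: full_beliefs_def beliefs_def less_imp_le)
  have "expect \<nu>' f = expect \<mu>1 f + c * (expect \<mu>1 f - expect \<mu>0 f)"
    by (simp add: \<nu>'_def expect_inner inner_add_right inner_diff_right)
  then have f\<nu>': "0 < expect \<nu>' f"
    using f0 f1 c(1) by (simp add: add_nonneg_pos)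
  have "(\<lambda>n. iterate_bias D n (D \<mu>0 ms) \<nu>') \<longlonglongrightarrow> \<nu>'"
    using learn D_ms bel[OF \<nu>'] unfolding eventual_learning_def by blast
  then have "(\<lambda>n. expect (iterate_bias D n (D \<mu>0 ms) \<nu>') f) \<longlonglongrightarrow> expect \<nu>' f"
    unfolding expect_inner by (intro tendsto_intros)
  then have "\<forall>\<^sub>F n in sequentially. 0 < expect (iterate_bias D n (D \<mu>0 ms) \<nu>') f"
    using f\<nu>' order_tendstoD(1) by blast
  then obtain n where "0 < expect (iterate_bias D n (D \<mu>0 ms) \<nu>') f"
    by (auto simp: eventually_sequentially)
  then have "r a' < g (iterate_bias D n (D \<mu>0 ms) \<nu>')"
    using g[OF bel[OF iterate_bias_full[OF D D_ms bel[OF \<nu>']]]] r by simp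
  moreover have "r a' \<le> g \<mu>" if "\<mu> \<in> full_beliefs" for \<mu>
    using g[OF bel[OF that]] r by simp
  ultimately obtain \<sigma> where \<sigma>: "bounded_strategy X n \<sigma>"
    "\<And>w. r a' < continuation_value D g \<sigma> (D \<mu>0 ms) w"
    using persuade_with_positive_probability[OF D X _ D_ms \<nu>', of "r a'" g n] by blast

  \<comment> \<open>\<open>X\<close> is infinite, so each posterior in the support of
    \<open>\<tau>\<close> gets its own signal.\<close>
  obtain B where B: "finite B" "card B = card ?S" "B \<subseteq> X"
    using infinite_arbitrarily_large[OF X] by blast
  then obtain e where "e ` ?S \<subseteq> B" and inj: "inj_on e ?S"
    using card_le_inj[OF S(1) B(1)] by auto
  then have e: "e ` ?S \<subseteq> X"
    using B(3) by blast
  obtain s where s: "info_structure X s" "\<And>w. set_pmf (s w) \<subseteq> e ` ?S"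
    "\<And>m w. m \<in> ?S \<Longrightarrow> pmf (s w) (e m) = pmf \<tau> m * m $ w / \<mu>0 $ w"
    "\<And>m. m \<in> ?S \<Longrightarrow> bayes_posterior \<mu>0 s (e m) = m"
    using ex_info_structure_splitting[OF \<mu>0 S(1) inj e S(2) _ mean] by (auto simp: pmf_positive_iff)
  \<comment> \<open>The optimal one-shot experiment is run first and persuasion continues only after
    the failing posterior \<open>ms\<close>.\<close>
  define \<rho> where "\<rho> x = (if x = e ms then \<sigma> else stop_strategy)" for x
  have \<rho>: "bounded_strategy X n (\<rho> x)" for x
    using \<sigma>(1) by (simp add: \<rho>_def)
  define V where "V m w = continuation_value D g (\<rho> (e m)) (D \<mu>0 m) w" for m w
  have V: "V m = (\<lambda>w. g (D \<mu>0 m))" if "m \<in> ?S" "m \<noteq> ms" for m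
    using that inj_onD[OF inj _ that(1) ms(1)] by (intro ext) (auto simp: V_def \<rho>_def)

  have "sequential_payoff D A u v \<mu>0 (branch_strategy s \<rho>) =
      expect \<mu>0 (\<lambda>w. \<Sum>m\<in>?S. pmf (s w) (e m) * V m w)"
    unfolding sequential_payoff_eq_continuation_value v_g
    using s(2,4) S(1) finite_terminal_histories[OF \<rho>]
    by (subst continuation_value_branch[of "e ` ?S"]) (auto simp: sum.reindex[OF inj] V_def)
  \<comment> \<open>The prior cancels the denominator in the signal probabilities. Exchanging the
    sums afterwards groups the payoff by the true posterior \<open>m\<close>.\<close>
  also have "\<dots> = (\<Sum>w\<in>UNIV. \<Sum>m\<in>?S. pmf \<tau> m * (m $ w * V m w))"
  proof -
    have "\<mu>0 $ w \<noteq> 0" for w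
      using \<mu>0 by (auto simp: full_beliefs_def less_le)
    then show ?thesis
      unfolding expect_def sum_distrib_left by (intro sum.cong) (auto simp: s(3))
  qed
  also have "\<dots> = (\<Sum>m\<in>?S. pmf \<tau> m * expect m (V m))"
    unfolding expect_def sum_distrib_left by (rule sum.swap)
  finally have seq: "sequential_payoff D A u v \<mu>0 (branch_strategy s \<rho>) =
    (\<Sum>m\<in>?S. pmf \<tau> m * expect m (V m))" .

  have "one_shot_payoff D A u v \<mu>0 \<tau> = (\<Sum>m\<in>?S. pmf \<tau> m * g (D \<mu>0 m))"
    unfolding one_shot_payoff_def v_g using S(2) by (simp add: expect_const)
  \<comment> \<open>Both payoffs agree at every \<open>m\<close> other than \<open>ms\<close>, where
    the sequential one is strictly larger.\<close>
  also have "\<dots> < (\<Sum>m\<in>?S. pmf \<tau> m * expect m (V m))"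
  proof (rule sum_strict_mono_ex1[OF S(1)])
    have "r a' < expect ms (V ms)"
      using \<sigma>(2) by (intro expect_gt S(2) ms(1)) (simp add: V_def \<rho>_def)
    moreover have "g (D \<mu>0 ms) = r a'"
      using g[OF bel[OF D_ms]] ms(2) by simp
    ultimately have less: "pmf \<tau> ms * g (D \<mu>0 ms) < pmf \<tau> ms * expect ms (V ms)"
      using ms(1) by (simp add: pmf_positive_iff)
    then show "\<exists>m\<in>?S. pmf \<tau> m * g (D \<mu>0 m) < pmf \<tau> m * expect m (V m)"
      using ms(1) by blast
    show "\<forall>m\<in>?S. pmf \<tau> m * g (D \<mu>0 m) \<le> pmf \<tau> m * expect m (V m)"
    proof
      fix m assume "m \<in> ?S"
      then show "pmf \<tau> m * g (D \<mu>0 m) \<le> pmf \<tau> m * expect m (V m)"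
        using less by (cases "m = ms") (auto simp: V expect_const S(2))
    qed
  qed
  finally have "one_shot_payoff D A u v \<mu>0 \<tau> <
      sequential_payoff D A u v \<mu>0 (branch_strategy s \<rho>)"
    by (simp add: seq)
  moreover have "one_shot_value D A u v \<mu>0 = one_shot_payoff D A u v \<mu>0 \<tau>"
    using one_shot_value_eq[OF \<tau>] opt by blast
  moreover have "sequential_strategy X (branch_strategy s \<rho>)"
    using bounded_imp_sequential_strategy[OF bounded_strategy_branch[OF s(1) \<rho>]] .
  ultimately show ?thesis
    unfolding gains_from_sequential_persuasion_def by metis
qed

section \<open>An environment without gain for an implausible bias\<close>

lemma environment_without_gain:
  fixes D :: "'w::finite bias" and X :: "'x set" and a a' :: 'a
  assumes ne: "a \<noteq> a'" and D: "interior_bias D" and implausible: "\<not> weakly_Bayes_plausible D"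
  obtains u v \<mu>0 where "two_action_environment {a, a'} u v \<mu>0"
    "one_shot_max_attained D {a, a'} u v \<mu>0"
    "\<not> gains_from_sequential_persuasion X D {a, a'} u v \<mu>0"
proof -
  obtain \<mu>0 F where \<mu>0: "\<mu>0 \<in> full_beliefs" and F: "finite F" "F \<subseteq> beliefs"
    and hull: "\<mu>0 \<in> convex hull F" and not_hull: "\<mu>0 \<notin> convex hull (D \<mu>0 ` F)"
    using implausible unfolding weakly_Bayes_plausible_def by blast
  have "closed (convex hull (D \<mu>0 ` F))"
    using F(1) by (intro compact_imp_closed finite_imp_compact_convex_hull) simp
  then obtain z \<beta> where z: "z \<bullet> \<mu>0 < \<beta>" "\<And>x. x \<in> convex hull (D \<mu>0 ` F) \<Longrightarrow> \<beta> < z \<bullet> x"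
    using separating_hyperplane_closed_point[OF convex_convex_hull _ not_hull] by blast
  \<comment> \<open>On beliefs the constant \<open>\<beta>\<close> has expectation
    \<open>\<beta>\<close>, so R prefers \<open>a\<close> exactly on one side of the hyperplane.
    With S's utilities 0 and -1, no payoff can exceed 0.\<close>
  define u where "u w b = (if b = a then z $ w - \<beta> else 0)" for w b
  define v :: "'w \<Rightarrow> 'a \<Rightarrow> real" where "v w b = (if b = a then 0 else - 1)" for w b
  have v: "v w b \<le> 0" for w b
    by (simp add: v_def)
  have act: "receiver_action {a, a'} u v \<mu> = (if \<beta> \<le> z \<bullet> \<mu> then a else a')"
    if "\<mu> \<in> beliefs" for \<mu>
  proof -
    have "expect \<mu> (\<lambda>w. u w a - u w a') = z \<bullet> \<mu> - \<beta>"
      using that ne by (simp add: u_def expect_diff expect_const expect_inner[of \<mu> "\<lambda>w. z $ w"])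
    then show ?thesis
      using receiver_action_two[OF that, of a a' v "\<lambda>b. if b = a then 0 else - 1" u] ne
      by (simp add: v_def)
  qed
  have D_full: "D \<mu>0 m \<in> full_beliefs" if "m \<in> F" for m
    using D \<mu>0 that F(2) by (auto simp: interior_bias_def)
  have act_F: "receiver_action {a, a'} u v (D \<mu>0 m) = a" if "m \<in> F" for m
    using act[of "D \<mu>0 m"] z(2)[of "D \<mu>0 m"] D_full[OF that] full_beliefs_subset that
    by (auto simp: hull_inc)
  \<comment> \<open>Some distorted posterior exists; being interior, it is the full-support belief
    at which the environment requires action \<open>a\<close>.\<close>
  have "F \<noteq> {}"
    using hull by auto
  then have "\<exists>\<mu>\<in>full_beliefs. receiver_action {a, a'} u v \<mu> = a"
    using D_full act_F by blast
  moreover have "receiver_action {a, a'} u v \<mu>0 = a'"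
    using act[of \<mu>0] z(1) \<mu>0 full_beliefs_subset by auto
  ultimately have env: "two_action_environment {a, a'} u v \<mu>0"
    unfolding two_action_environment_def using \<mu>0 ne
    by (intro conjI exI[of _ a] exI[of _ a']) (auto simp: v_def)

  obtain c where c: "\<And>m. m \<in> F \<Longrightarrow> 0 \<le> c m" "sum c F = 1" "(\<Sum>m\<in>F. c m *\<^sub>R m) = \<mu>0"
    using hull F(1) by (auto simp: convex_hull_finite)
  \<comment> \<open>The convex weights serve as the experiment; points of weight zero drop out of
    its support.\<close>
  then obtain \<tau> where \<tau>: "set_pmf \<tau> \<subseteq> F" "\<And>m. m \<in> F \<Longrightarrow> pmf \<tau> m = c m"
    using ex_pmf_image[OF F(1), of id c] by auto
  have "(\<Sum>m\<in>set_pmf \<tau>. pmf \<tau> m *\<^sub>R m) = (\<Sum>m\<in>F. pmf \<tau> m *\<^sub>R m)"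
    using F(1) \<tau>(1) by (intro sum.mono_neutral_left) (auto simp: set_pmf_iff)
  then have feasible: "\<tau> \<in> one_shot_feasible \<mu>0"
    using \<tau> F c(3) by (auto simp: one_shot_feasible_def finite_subset)
  have payoff: "one_shot_payoff D {a, a'} u v \<mu>0 \<tau> = 0"
    unfolding one_shot_payoff_def using act_F \<tau>(1)
    by (intro sum.neutral) (auto simp: v_def expect_def)
  have opt: "one_shot_payoff D {a, a'} u v \<mu>0 \<tau>' \<le> one_shot_payoff D {a, a'} u v \<mu>0 \<tau>"
    if "\<tau>' \<in> one_shot_feasible \<mu>0" for \<tau>'
    unfolding payoff unfolding one_shot_payoff_def using that v
    by (intro sum_nonpos mult_nonneg_nonpos expect_nonpos) (auto simp: one_shot_feasible_def)
  have "one_shot_value D {a, a'} u v \<mu>0 = 0"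
    using one_shot_value_eq[OF feasible] opt payoff by metis
  moreover have "one_shot_max_attained D {a, a'} u v \<mu>0"
    unfolding one_shot_max_attained_def using feasible opt by blast
  \<comment> \<open>Nonnegative probabilities multiply nonpositive utilities. This covers every
    \<open>\<sigma>\<close>, since a sum over an infinite set defaults to 0.\<close>
  moreover have "sequential_payoff D {a, a'} u v \<mu>0 \<sigma> \<le> 0" for \<sigma> :: "('w, 'x) strategy"
    unfolding sequential_payoff_def using \<mu>0 full_beliefs_subset v
    by (intro expect_nonpos sum_nonpos mult_nonneg_nonpos history_prob_nonneg) auto
  ultimately show ?thesis
    using that[OF env] by (auto simp: gains_from_sequential_persuasion_def not_less)
qed

theorem proposition1:
  fixes D :: "'w::finite bias"
    and X :: "'x set"
  assumes "infinite X"
    and "\<exists>a a' :: 'a. a \<noteq> a'"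
    and "is_bias D"
    and "interior_bias D"
    and "eventual_learning D"
  shows "(\<forall>(A :: 'a set) u v \<mu>0.
            two_action_environment A u v \<mu>0 \<and> one_shot_max_attained D A u v \<mu>0
              \<longrightarrow> gains_from_sequential_persuasion X D A u v \<mu>0)
         \<longleftrightarrow> weakly_Bayes_plausible D" (is "?gains \<longleftrightarrow> _")
proof
  obtain a a' :: 'a where "a \<noteq> a'"
    using assms(2) by blast
  then show "weakly_Bayes_plausible D" if ?gains
    using that environment_without_gain[OF _ assms(4), where X = X] by metis
  show ?gains if "weakly_Bayes_plausible D"
    using gains_if_weakly_Bayes_plausible[OF assms(1,4,5) that] by blast
qed

end
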